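(* Let $\mathcal{V}$ be a $d$-dimensional linear subspace of $\mathbb{R}^m$ equipped with the scalar product $(x,y)_A=\langle x,Ay\rangle$, where $A$ is a diagonal positive $m\times m$-matrix. Let $c:[0,\infty)\to\mathcal{V}$ satisfy $c'(t)=c_1$ for all $t\ge0$, with $c_1\in\mathcal{V}$ fixed. Let $c_j^-,c_j^+\in\mathbb{R}$ ($j=1,\dots,m$), and for $\alpha\in\{-1,1\}$ put $$L(\alpha,j)=\{y\in\mathcal{V}:\langle\alpha e_j,Ay\rangle\le\alpha c_j^\alpha\},\quad \overline{\overline L}(\alpha,j)=\{y\in\mathcal{V}:\langle e_j,Ay\rangle=c_j^\alpha\},$$ $$C=\bigcap_{j=1}^m\big(L(-1,j)\cap L(1,j)\big),\qquad C(t)=C+c(t).$$ Let $M\ge1$, let $I_0,I_1,\dots,I_M\subset\{-1,1\}\times\{1,\dots,m\}$, and let $$F=\Big(\bigcap_{(\alpha,j)\in I_0}\overline{\overline L}(\alpha,j)\Big)\cap\Big(\bigcap_{i=1}^M\bigcap_{(\alpha,j)\in I_i}L(\alpha,j)\Big),\qquad F(t)=F+c(t),$$ with ${\rm ri}(F)\neq\emptyset$. Assume: (1) for each $i\in\{1,\dots,M\}$ the set $\bigcap_{(\alpha,j)\in I_0\cup I_i}\overline{\overline L}(\alpha,j)$ is a singleton $\{y_{*,i}\}$, with $y_{*,i}\in F$; (2) for each $y\in F$ there is a (possibly empty) set $J_y\subset\{1,\dots,M\}$ such that $\{(\alpha,j):y\in\overline{\overline L}(\alpha,j)\}=I_0\cup\bigcap_{i\in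 J_y}I_i$; (3) for each $i\in\{1,\dots,M\}$ one has $J_{y_{*,i}}=\{i\}$, i.e. $\{(\alpha,j):y_{*,i}\in\overline{\overline L}(\alpha,j)\}=I_0\cup I_i$; (4) $\{(\alpha,j):y\in\overline{\overline L}(\alpha,j)\}=I_0$ for every $y\in{\rm ri}(F)$; (5) $F\subset C$. If $$-c_1\in{\rm ri}\big(N^A_C(y)\big)\quad\text{for } y\in{\rm ri}(F),$$ then there exists $\varepsilon>0$ such that for every $\tau_d>0$ $$-c'(t)+B^A_\varepsilon(0)\cap N^A_F(y)\subset N^A_C(y)\quad\text{for all }y\in F,\ t\in[0,\tau_d],$$ and, in particular, the solution $y$ of the sweeping process $-\dot y(t)\in N^A_{C(t)}(y(t))$ with any initial condition $y(0)\in C(0)$ satisfies $y(\tau_d)\in F(\tau_d)$ for all sufficiently large $\tau_d>0$.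
   Context: $\langle\cdot,\cdot\rangle$ is the Euclidean scalar product and $e_j$ the standard basis of $\mathbb{R}^m$; $c_j^{\alpha}$ means $c_j^+$ for $\alpha=1$ and $c_j^-$ for $\alpha=-1$. In (2), the intersection over $J_y=\emptyset$ is understood as the empty set. ${\rm ri}$ denotes relative interior. $\|x\|^A=\sqrt{\langle x,Ax\rangle}$; $B^A_\varepsilon(0)=\{x\in\mathcal{V}:\|x\|^A\le\varepsilon\}$. For a closed convex $K\subset\mathcal{V}$: $N^A_K(y)=\{x\in\mathcal{V}:\langle x,A(\xi-y)\rangle\le 0\ \forall\xi\in K\}$ if $y\in K$, and $\emptyset$ otherwise. A solution of the sweeping process is a locally absolutely continuous function $y:[0,\infty)\to\mathcal{V}$ with $y(t)\in C(t)$ for all $t$ satisfying the inclusion for almost every $t$. *)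

theory Defs
  imports "HOL-Analysis.Analysis"
begin

text \<open>A pair \<open>(\<alpha>, j)\<close> has \<open>\<alpha> \<in> {-1, 1} :: int set\<close> and \<open>j\<close> in the finite index type \<open>'m\<close>
  of \<open>real ^ 'm\<close>. The subspace \<open>V\<close> is an explicit set parameter, and all vectors live in
  the ambient space. The functions \<open>cm\<close> and \<open>cp\<close> give the lower bounds \<open>c\<^sub>j\<^sup>-\<close> and the
  upper bounds \<open>c\<^sub>j\<^sup>+\<close>.\<close>

definition diagonal_positive :: "real ^ 'm ^ 'm \<Rightarrow> bool" where
  "diagonal_positive A \<longleftrightarrow> (\<forall>i j. i \<noteq> j \<longrightarrow> A $ i $ j = 0) \<and> (\<forall>i. A $ i $ i > 0)"

definition Anorm :: "real ^ 'm ^ 'm \<Rightarrow> real ^ 'm \<Rightarrow> real" where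
  "Anorm A x = sqrt (x \<bullet> (A *v x))"

definition Aball :: "(real ^ 'm) set \<Rightarrow> real ^ 'm ^ 'm \<Rightarrow> real \<Rightarrow> (real ^ 'm) set" where
  "Aball V A \<epsilon> = {x \<in> V. Anorm A x \<le> \<epsilon>}"

definition normal_cone ::
  "(real ^ 'm) set \<Rightarrow> real ^ 'm ^ 'm \<Rightarrow> (real ^ 'm) set \<Rightarrow> real ^ 'm \<Rightarrow> (real ^ 'm) set" where
  "normal_cone V A K y =
     (if y \<in> K then {x \<in> V. \<forall>\<xi>\<in>K. x \<bullet> (A *v (\<xi> - y)) \<le> 0} else {})"

definition bnd :: "('m \<Rightarrow> real) \<Rightarrow> ('m \<Rightarrow> real) \<Rightarrow> int \<Rightarrow> 'm \<Rightarrow> real" where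
  "bnd cm cp \<alpha> j = (if \<alpha> = 1 then cp j else cm j)"

definition halfsp :: "(real ^ 'm) set \<Rightarrow> real ^ 'm ^ 'm \<Rightarrow> ('m \<Rightarrow> real) \<Rightarrow> ('m \<Rightarrow> real)
    \<Rightarrow> int \<Rightarrow> 'm \<Rightarrow> (real ^ 'm) set" where
  "halfsp V A cm cp \<alpha> j =
     {y \<in> V. (of_int \<alpha> *\<^sub>R axis j 1) \<bullet> (A *v y) \<le> of_int \<alpha> * bnd cm cp \<alpha> j}"

definition hypersp :: "(real ^ 'm) set \<Rightarrow> real ^ 'm ^ 'm \<Rightarrow> ('m \<Rightarrow> real) \<Rightarrow> ('m \<Rightarrow> real)
    \<Rightarrow> int \<Rightarrow> 'm \<Rightarrow> (real ^ 'm) set" where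
  "hypersp V A cm cp \<alpha> j = {y \<in> V. axis j 1 \<bullet> (A *v y) = bnd cm cp \<alpha> j}"

definition active :: "(real ^ 'm) set \<Rightarrow> real ^ 'm ^ 'm \<Rightarrow> ('m \<Rightarrow> real) \<Rightarrow> ('m \<Rightarrow> real)
    \<Rightarrow> real ^ 'm \<Rightarrow> (int \<times> 'm) set" where
  "active V A cm cp y = {(\<alpha>, j). \<alpha> \<in> {-1, 1} \<and> y \<in> hypersp V A cm cp \<alpha> j}"

definition Cset :: "(real ^ 'm) set \<Rightarrow> real ^ 'm ^ 'm \<Rightarrow> ('m \<Rightarrow> real) \<Rightarrow> ('m \<Rightarrow> real)
    \<Rightarrow> (real ^ 'm) set" where
  "Cset V A cm cp = (\<Inter>j. halfsp V A cm cp (-1) j \<inter> halfsp V A cm cp 1 j)"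

text \<open>Families of subsets of \<open>V\<close> are intersected inside \<open>V\<close>: the leading \<open>V \<inter>\<close> matters only
  for empty families, whose intersection would otherwise be \<open>UNIV\<close>.\<close>

definition hyper_inter :: "(real ^ 'm) set \<Rightarrow> real ^ 'm ^ 'm \<Rightarrow> ('m \<Rightarrow> real) \<Rightarrow> ('m \<Rightarrow> real)
    \<Rightarrow> (int \<times> 'm) set \<Rightarrow> (real ^ 'm) set" where
  "hyper_inter V A cm cp S = V \<inter> (\<Inter>(\<alpha>, j)\<in>S. hypersp V A cm cp \<alpha> j)"

definition Fset :: "(real ^ 'm) set \<Rightarrow> real ^ 'm ^ 'm \<Rightarrow> ('m \<Rightarrow> real) \<Rightarrow> ('m \<Rightarrow> real)
    \<Rightarrow> (nat \<Rightarrow> (int \<times> 'm) set) \<Rightarrow> nat \<Rightarrow> (real ^ 'm) set" where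
  "Fset V A cm cp I M =
     hyper_inter V A cm cp (I 0) \<inter>
     (\<Inter>i\<in>{1..M}. \<Inter>(\<alpha>, j)\<in>I i. halfsp V A cm cp \<alpha> j)"

text \<open>Here, in contrast, the intersection over an empty index set is the empty set.\<close>

definition inter_or_empty :: "(nat \<Rightarrow> 'b set) \<Rightarrow> nat set \<Rightarrow> 'b set" where
  "inter_or_empty I J = (if J = {} then {} else (\<Inter>i\<in>J. I i))"

definition translate :: "'a::ab_group_add set \<Rightarrow> 'a \<Rightarrow> 'a set" where
  "translate S v = (\<lambda>x. x + v) ` S"

definition abs_cont_on_interval :: "real \<Rightarrow> real \<Rightarrow> (real \<Rightarrow> 'a::real_normed_vector) \<Rightarrow> bool" where
  "abs_cont_on_interval a b f \<longleftrightarrow>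
     (\<forall>\<epsilon>>0. \<exists>\<delta>>0. \<forall>n l r.
        (\<forall>k<n. a \<le> l k \<and> l k \<le> r k \<and> r k \<le> b) \<and>
        disjoint_family_on (\<lambda>k. {l k<..<r k}) {..<n} \<and>
        (\<Sum>k<n. r k - l k) < \<delta>
        \<longrightarrow> (\<Sum>k<(n::nat). norm (f (r k) - f (l k))) < \<epsilon>)"

definition loc_abs_cont :: "(real \<Rightarrow> 'a::real_normed_vector) \<Rightarrow> bool" where
  "loc_abs_cont f \<longleftrightarrow> (\<forall>T\<ge>0. abs_cont_on_interval 0 T f)"

definition sweeping_solution :: "(real ^ 'm) set \<Rightarrow> real ^ 'm ^ 'm \<Rightarrow> (real \<Rightarrow> (real ^ 'm) set)
    \<Rightarrow> (real \<Rightarrow> real ^ 'm) \<Rightarrow> bool" where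
  "sweeping_solution V A K y \<longleftrightarrow>
     (\<forall>t\<ge>0. y t \<in> V) \<and> loc_abs_cont y \<and> (\<forall>t\<ge>0. y t \<in> K t) \<and>
     (AE t in lebesgue. t \<ge> 0 \<longrightarrow>
        (\<exists>v. (y has_vector_derivative v) (at t) \<and> - v \<in> normal_cone V A (K t) (y t)))"

end

theory Submission
  imports Defs
begin

text \<open>The set \<open>C\<close> lies in every halfspace that occurs in \<open>F\<close>, so \<open>F\<close> is the face
  \<open>C \<inter> hyper_inter V A cm cp (I 0)\<close>. The relative interior condition says that this face is the set
  of minimizers over \<open>C\<close> of the linear function \<open>x \<mapsto> (c1, x)\<^sub>A\<close>. As \<open>C\<close> is a polytope, the minimum
  is weakly sharp: the function exceeds its minimum at \<open>x\<close> by at least \<open>\<kappa>\<close> times the distance from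
  \<open>x\<close> to \<open>F\<close>. A normal vector to \<open>F\<close> of norm at most \<open>\<kappa>\<close> cannot compensate this growth, whence
  the inclusion with \<open>\<epsilon> = \<kappa>\<close>. For a solution \<open>y\<close> and \<open>p \<in> F\<close>, the derivative of
  \<open>\<parallel>y - c - p\<parallel>\<^sup>2\<close> is at most \<open>-2 \<kappa> D\<close>, where \<open>D\<close> is the distance from \<open>y - c\<close> to \<open>F\<close>.
  Integrating with \<open>p\<close> the projection at the initial time gives
  \<open>D(t)\<^sup>2 \<le> D(s)\<^sup>2 - 2 \<kappa> (t - s) D(t)\<close>, so \<open>D\<close> vanishes after finite time.\<close>

subsection \<open>Absolute continuity\<close>

lemma abs_cont_on_subinterval:
  assumes "abs_cont_on_interval a b f" "a \<le> a'" "b' \<le> b"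
  shows "abs_cont_on_interval a' b' f"
  unfolding abs_cont_on_interval_def
proof (intro allI impI)
  fix \<epsilon> :: real assume "\<epsilon> > 0"
  with assms(1) obtain \<delta> where "\<delta> > 0" and \<delta>: "\<forall>n l r.
        (\<forall>k<n. a \<le> l k \<and> l k \<le> r k \<and> r k \<le> b) \<and>
        disjoint_family_on (\<lambda>k. {l k<..<r k}) {..<n} \<and>
        (\<Sum>k<n. r k - l k) < \<delta>
        \<longrightarrow> (\<Sum>k<(n::nat). norm (f (r k) - f (l k))) < \<epsilon>"
    unfolding abs_cont_on_interval_def by blast
  show "\<exists>\<delta>>0. \<forall>n l r.
        (\<forall>k<n. a' \<le> l k \<and> l k \<le> r k \<and> r k \<le> b') \<and>
        disjoint_family_on (\<lambda>k. {l k<..<r k}) {..<n} \<and>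
        (\<Sum>k<n. r k - l k) < \<delta>
        \<longrightarrow> (\<Sum>k<(n::nat). norm (f (r k) - f (l k))) < \<epsilon>"
    using assms(2,3) by (intro exI[of _ \<delta>] conjI \<open>\<delta> > 0\<close> allI impI \<delta>[rule_format]) force+
qed

text \<open>A tagged division is a finite set of pairs, while the definition of absolute continuity
  numbers its intervals by an initial segment of the naturals. An enumeration of \<open>P\<close>
  carries the bound over.\<close>

lemma abs_cont_finite_sum_less:
  fixes f :: "real \<Rightarrow> 'a::real_normed_vector"
  assumes "abs_cont_on_interval a b f" "\<epsilon> > 0"
  obtains \<delta> where "\<delta> > 0"
    "\<And>P l r. finite P \<Longrightarrow> (\<And>k. k \<in> P \<Longrightarrow> a \<le> l k \<and> l k \<le> r k \<and> r k \<le> b)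
       \<Longrightarrow> disjoint_family_on (\<lambda>k. {l k<..<r k}) P \<Longrightarrow> (\<Sum>k\<in>P. r k - l k) < \<delta>
       \<Longrightarrow> (\<Sum>k\<in>P. norm (f (r k) - f (l k))) < \<epsilon>"
proof -
  obtain \<delta> where "\<delta> > 0" and \<delta>: "\<forall>n l r.
        (\<forall>k<n. a \<le> l k \<and> l k \<le> r k \<and> r k \<le> b) \<and>
        disjoint_family_on (\<lambda>k. {l k<..<r k}) {..<n} \<and>
        (\<Sum>k<n. r k - l k) < \<delta>
        \<longrightarrow> (\<Sum>k<(n::nat). norm (f (r k) - f (l k))) < \<epsilon>"
    using assms unfolding abs_cont_on_interval_def by blast
  show thesis
  proof (rule that[OF \<open>\<delta> > 0\<close>])
    fix P :: "'b set" and l r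
    assume P: "finite P" and lr: "\<And>k. k \<in> P \<Longrightarrow> a \<le> l k \<and> l k \<le> r k \<and> r k \<le> b"
      and disj: "disjoint_family_on (\<lambda>k. {l k<..<r k}) P" and len: "(\<Sum>k\<in>P. r k - l k) < \<delta>"
    obtain e where e: "bij_betw e {..<card P} P"
      using ex_bij_betw_nat_finite[OF P] atLeast0LessThan by auto
    have eP: "e k \<in> P" if "k < card P" for k
      using e that by (auto simp: bij_betw_def)
    have "disjoint_family_on (\<lambda>k. {l (e k)<..<r (e k)}) {..<card P}"
      using disj eP e unfolding disjoint_family_on_def bij_betw_def inj_on_def
      by (metis lessThan_iff)
    then have "(\<Sum>k<card P. norm (f (r (e k)) - f (l (e k)))) < \<epsilon>"
      using lr eP len sum.reindex_bij_betw[OF e, of "\<lambda>k. r k - l k"]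
      by (intro \<delta>[rule_format]) auto
    then show "(\<Sum>k\<in>P. norm (f (r k) - f (l k))) < \<epsilon>"
      using sum.reindex_bij_betw[OF e, of "\<lambda>k. norm (f (r k) - f (l k))"] by simp
  qed
qed

text \<open>Serves to pass from a solution to a squared distance along it. The summand
  \<open>r - l\<close> absorbs the explicit dependence of that distance on time.\<close>

lemma abs_cont_on_interval_dominated:
  fixes f :: "real \<Rightarrow> 'a::real_normed_vector" and g :: "real \<Rightarrow> 'b::real_normed_vector"
  assumes f: "abs_cont_on_interval a b f"
    and "\<And>l r. a \<le> l \<Longrightarrow> l \<le> r \<Longrightarrow> r \<le> b \<Longrightarrow>
      norm (g r - g l) \<le> K * (norm (f r - f l) + (r - l))"
  shows "abs_cont_on_interval a b g"
  unfolding abs_cont_on_interval_def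
proof (intro allI impI)
  fix \<epsilon> :: real assume "\<epsilon> > 0"
  \<comment> \<open>The sign of \<open>K\<close> is arbitrary, so a positive upper bound replaces
    it. The tolerance is then shared equally between the increments of \<open>f\<close> and the
    lengths.\<close>
  define L where "L = \<bar>K\<bar> + 1"
  have "L > 0" by (simp add: L_def)
  have g: "norm (g r - g l) \<le> L * (norm (f r - f l) + (r - l))" if "a \<le> l" "l \<le> r" "r \<le> b" for l r
    using assms(2)[OF that] that
    by (smt (verit, best) L_def mult_right_mono norm_ge_zero)
  have "\<epsilon> / (2 * L) > 0" using \<open>\<epsilon> > 0\<close> \<open>L > 0\<close> by simp
  with f obtain \<delta> where "\<delta> > 0" and \<delta>: "\<forall>n l r.
        (\<forall>k<n. a \<le> l k \<and> l k \<le> r k \<and> r k \<le> b) \<and>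
        disjoint_family_on (\<lambda>k. {l k<..<r k}) {..<n} \<and>
        (\<Sum>k<n. r k - l k) < \<delta>
        \<longrightarrow> (\<Sum>k<(n::nat). norm (f (r k) - f (l k))) < \<epsilon> / (2 * L)"
    unfolding abs_cont_on_interval_def by blast
  show "\<exists>\<delta>>0. \<forall>n l r.
        (\<forall>k<n. a \<le> l k \<and> l k \<le> r k \<and> r k \<le> b) \<and>
        disjoint_family_on (\<lambda>k. {l k<..<r k}) {..<n} \<and>
        (\<Sum>k<n. r k - l k) < \<delta>
        \<longrightarrow> (\<Sum>k<(n::nat). norm (g (r k) - g (l k))) < \<epsilon>"
  proof (intro exI[of _ "min \<delta> (\<epsilon> / (2 * L))"] conjI allI impI; (elim conjE)?)
    show "0 < min \<delta> (\<epsilon> / (2 * L))" using \<open>\<delta> > 0\<close> \<open>\<epsilon> / (2 * L) > 0\<close> by simp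
    fix n :: nat and l r
    assume lr: "\<forall>k<n. a \<le> l k \<and> l k \<le> r k \<and> r k \<le> b"
      and disj: "disjoint_family_on (\<lambda>k. {l k<..<r k}) {..<n}"
      and len: "(\<Sum>k<n. r k - l k) < min \<delta> (\<epsilon> / (2 * L))"
    have "(\<Sum>k<n. norm (g (r k) - g (l k))) \<le> (\<Sum>k<n. L * (norm (f (r k) - f (l k)) + (r k - l k)))"
      using g lr by (intro sum_mono) auto
    also have "\<dots> = L * ((\<Sum>k<n. norm (f (r k) - f (l k))) + (\<Sum>k<n. r k - l k))"
      by (simp add: sum.distrib flip: sum_distrib_left)
    also have "\<dots> < L * (\<epsilon> / (2 * L) + \<epsilon> / (2 * L))"
      using \<delta>[rule_format, of n l r] lr disj len \<open>L > 0\<close> by (intro mult_strict_left_mono add_strict_mono) auto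
    also have "\<dots> = \<epsilon>" using \<open>L > 0\<close> by (simp add: field_simps)
    finally show "(\<Sum>k<n. norm (g (r k) - g (l k))) < \<epsilon>" .
  qed
qed

text \<open>Take a tagged division fine enough that intervals tagged in \<open>N\<close> lie in an open set of small
  measure, where absolute continuity controls the increments, and that on all other intervals the
  increment is at most \<open>e\<close> times the length.\<close>

lemma abs_cont_deriv_nonpos_imp_le:
  fixes f :: "real \<Rightarrow> real"
  assumes ac: "abs_cont_on_interval a b f" and "a \<le> b" and N: "N \<in> null_sets lebesgue"
    and deriv: "\<And>t. t \<in> {a..b} - N \<Longrightarrow> \<exists>D\<le>0. (f has_real_derivative D) (at t)"
  shows "f b \<le> f a"
proof (rule field_le_epsilon)
  fix e' :: real assume "e' > 0"
  \<comment> \<open>The intervals tagged outside \<open>N\<close> contribute at most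
    \<open>e * (b - a)\<close> and those tagged in \<open>N\<close> at most \<open>e\<close>, which
    adds up to \<open>e'\<close>.\<close>
  define e where "e = e' / (b - a + 1)"
  have "e > 0" using \<open>e' > 0\<close> \<open>a \<le> b\<close> by (simp add: e_def)
  obtain \<delta> where "\<delta> > 0"
    and \<delta>: "\<And>P l r. finite (P :: (real \<times> real set) set) \<Longrightarrow>
       (\<And>k. k \<in> P \<Longrightarrow> a \<le> l k \<and> l k \<le> r k \<and> r k \<le> b)
       \<Longrightarrow> disjoint_family_on (\<lambda>k. {l k<..<r k}) P \<Longrightarrow> (\<Sum>k\<in>P. r k - l k) < \<delta>
       \<Longrightarrow> (\<Sum>k\<in>P. norm (f (r k) - f (l k))) < e"
    by (rule abs_cont_finite_sum_less[OF ac \<open>e > 0\<close>]) blast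
  obtain U where U: "open U" "N \<subseteq> U" "U - N \<in> lmeasurable" "emeasure lebesgue (U - N) < ennreal \<delta>"
    using sets_lebesgue_outer_open[of N \<delta>] N \<open>\<delta> > 0\<close> by blast
  have Uleb: "U \<in> sets lebesgue" using U(1) by (simp add: borel_open sets_completionI_sets)
  have U\<delta>: "emeasure lebesgue U < ennreal \<delta>"
    using U(4) emeasure_Diff_null_set[OF N Uleb] by simp
  have "\<exists>s>0. (if t \<in> N then ball t s \<subseteq> U
          else t \<in> {a..b} \<longrightarrow> (\<forall>u v. u \<le> t \<longrightarrow> t \<le> v \<longrightarrow> u \<in> ball t s \<longrightarrow> v \<in> ball t s \<longrightarrow> f v - f u \<le> e * (v - u)))" for t
  proof (cases "t \<in> N")
    case True
    then show ?thesis using U openE by (metis subset_iff)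
  next
    case False
    show ?thesis
    proof (cases "t \<in> {a..b}")
      case True
      then obtain D where "D \<le> 0" and D: "(f has_real_derivative D) (at t)"
        using deriv False by blast
      from D obtain s where "s > 0" and s: "\<And>y. \<bar>y - t\<bar> < s \<Longrightarrow> \<bar>f y - f t - D * (y - t)\<bar> \<le> e * \<bar>y - t\<bar>"
        unfolding has_field_derivative_def has_derivative_at_alt using \<open>e > 0\<close>
        by (auto simp: real_norm_def)
      \<comment> \<open>Straddle argument: the increment is split at the tag \<open>t\<close>, and
        on both pieces the linear term is nonpositive because \<open>D \<le> 0\<close>.\<close>
      have "f v - f u \<le> e * (v - u)" if "u \<le> t" "t \<le> v" "u \<in> ball t s" "v \<in> ball t s" for u v
      proof -
        have "f v - f t - D * (v - t) \<le> e * (v - t)" "f t - f u - D * (t - u) \<le> e * (t - u)"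
          using s[of v] s[of u] that by (auto simp: dist_real_def abs_le_iff algebra_simps)
        moreover have "D * (v - t) \<le> 0" "D * (t - u) \<le> 0"
          using \<open>D \<le> 0\<close> that by (auto intro: mult_nonpos_nonneg)
        ultimately show ?thesis by (simp add: algebra_simps)
      qed
      then show ?thesis using False \<open>s > 0\<close> by auto
    qed (use False in \<open>auto intro: exI[of _ 1]\<close>)
  qed
  then obtain s where s0: "\<And>t. s t > 0"
    and sN: "\<And>t. t \<in> N \<Longrightarrow> ball t (s t) \<subseteq> U"
    and sD: "\<And>t u v. t \<notin> N \<Longrightarrow> t \<in> {a..b} \<Longrightarrow> u \<le> t \<Longrightarrow> t \<le> v \<Longrightarrow> u \<in> ball t (s t)
               \<Longrightarrow> v \<in> ball t (s t) \<Longrightarrow> f v - f u \<le> e * (v - u)"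
    by metis
  obtain p where p: "p tagged_division_of {a..b}" and fine: "(\<lambda>t. ball t (s t)) fine p"
    using fine_division_exists_real gauge_ball_dependent s0 by metis
  have fin: "finite p" using p by auto
  have pk: "a \<le> Inf k \<and> Inf k \<le> t \<and> t \<le> Sup k \<and> Sup k \<le> b \<and> {Inf k..Sup k} = k \<and> k \<subseteq> ball t (s t)"
    if tk: "(t, k) \<in> p" for t k
  proof -
    obtain u v where uv: "k = cbox u v" using tagged_division_ofD(4)[OF p tk] by blast
    have "t \<in> k" "k \<subseteq> {a..b}" using tagged_division_ofD(2,3)[OF p tk] by auto
    then show ?thesis using uv fine tk unfolding fine_def by (auto simp: subset_iff)
  qed
  define q where "q = {x \<in> p. fst x \<in> N}"
  have q: "finite q" "q \<subseteq> p" using fin by (auto simp: q_def)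
  have disj: "disjoint_family_on (\<lambda>x. {Inf (snd x)<..<Sup (snd x)}) p"
    unfolding disjoint_family_on_def
  proof (intro ballI impI)
    fix x y assume xy: "x \<in> p" "y \<in> p" "x \<noteq> y"
    then have "interior (snd x) \<inter> interior (snd y) = {}"
      using tagged_division_ofD(5)[OF p] by (metis prod.collapse)
    moreover have "{Inf (snd x)<..<Sup (snd x)} \<subseteq> interior (snd x)" if "x \<in> p" for x
      using pk[of "fst x" "snd x"] that by (metis interior_atLeastAtMost_real order_refl prod.collapse)
    ultimately show "{Inf (snd x)<..<Sup (snd x)} \<inter> {Inf (snd y)<..<Sup (snd y)} = {}"
      using xy by blast
  qed
  have disjq: "disjoint_family_on (\<lambda>x. {Inf (snd x)<..<Sup (snd x)}) q"
    using disj q(2) disjoint_family_on_mono by blast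
  have pk_le: "Inf (snd x) \<le> Sup (snd x)" if "x \<in> p" for x
    using pk[of "fst x" "snd x"] that by simp
  have "ennreal (\<Sum>x\<in>q. Sup (snd x) - Inf (snd x)) = (\<Sum>x\<in>q. emeasure lebesgue {Inf (snd x)<..<Sup (snd x)})"
    using pk_le q by (subst sum_ennreal[symmetric]) (auto intro!: sum.cong simp: subset_iff simp del: split_paired_All)
  also have "\<dots> = emeasure lebesgue (\<Union>x\<in>q. {Inf (snd x)<..<Sup (snd x)})"
    using q disjq by (intro sum_emeasure) auto
  also have "\<dots> \<le> emeasure lebesgue U"
  proof (rule emeasure_mono[OF _ Uleb], rule UN_least)
    fix x assume "x \<in> q"
    then have "{Inf (snd x)<..<Sup (snd x)} \<subseteq> ball (fst x) (s (fst x))" "fst x \<in> N"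
      using pk[of "fst x" "snd x"] greaterThanLessThan_subseteq_atLeastAtMost_iff by (auto simp: q_def)
    then show "{Inf (snd x)<..<Sup (snd x)} \<subseteq> U" using sN by blast
  qed
  also have "\<dots> < ennreal \<delta>" by (rule U\<delta>)
  finally have len: "(\<Sum>x\<in>q. Sup (snd x) - Inf (snd x)) < \<delta>"
    by (metis ennreal_leI linorder_not_less)
  have bad: "(\<Sum>x\<in>q. norm (f (Sup (snd x)) - f (Inf (snd x)))) < e"
    using q disjq len by (intro \<delta>) (auto dest!: pk)
  have "f b - f a = (\<Sum>x\<in>p. f (Sup (snd x)) - f (Inf (snd x)))"
    using additive_tagged_division_1[OF \<open>a \<le> b\<close> p, of f] by (simp add: case_prod_beta)
  \<comment> \<open>Granting \<open>e\<close> times the length to the intervals in \<open>q\<close>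
    as well is harmless, and lets the lengths telescope to \<open>b - a\<close>.\<close>
  also have "\<dots> \<le> (\<Sum>x\<in>p. e * (Sup (snd x) - Inf (snd x)) + (if x \<in> q then norm (f (Sup (snd x)) - f (Inf (snd x))) else 0))"
  proof (rule sum_mono, goal_cases)
    case (1 x)
    have k: "a \<le> Inf (snd x)" "Inf (snd x) \<le> fst x" "fst x \<le> Sup (snd x)" "Sup (snd x) \<le> b"
      "{Inf (snd x)..Sup (snd x)} = snd x" "snd x \<subseteq> ball (fst x) (s (fst x))"
      using pk[of "fst x" "snd x"] 1 by auto
    show ?case
    proof (cases "x \<in> q")
      case True
      have "e * (Sup (snd x) - Inf (snd x)) \<ge> 0"
        using k \<open>e > 0\<close> by simp
      then show ?thesis using True by (auto simp: abs_if)
    next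
      case False
      have "Inf (snd x) \<in> {Inf (snd x)..Sup (snd x)}" "Sup (snd x) \<in> {Inf (snd x)..Sup (snd x)}"
        using k by auto
      then have "f (Sup (snd x)) - f (Inf (snd x)) \<le> e * (Sup (snd x) - Inf (snd x))"
        using k False 1 by (intro sD[of "fst x"]) (auto simp: q_def)
      then show ?thesis using False by simp
    qed
  qed
  also have "\<dots> = e * (\<Sum>x\<in>p. Sup (snd x) - Inf (snd x)) + (\<Sum>x\<in>q. norm (f (Sup (snd x)) - f (Inf (snd x))))"
    using q fin by (simp add: sum.distrib sum_distrib_left sum.If_cases Int_absorb1)
  also have "\<dots> = e * (b - a) + (\<Sum>x\<in>q. norm (f (Sup (snd x)) - f (Inf (snd x))))"
    using additive_tagged_division_1[OF \<open>a \<le> b\<close> p, of "\<lambda>x. x"] by (simp add: case_prod_beta)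
  also have "\<dots> \<le> e * (b - a + 1)" using bad by (simp add: algebra_simps)
  also have "\<dots> = e'" using \<open>a \<le> b\<close> by (simp add: e_def)
  finally show "f b \<le> f a + e'" by simp
qed

subsection \<open>Weakly sharp minima on polytopes\<close>

text \<open>Write \<open>x\<close> as a convex combination of finitely many generators and move the
  weight of every generator that is not a minimizer to \<open>v0\<close>. The displacement is at
  most \<open>R\<close> times the moved weight, and the excess of \<open>f\<close> is at least
  \<delta> times it.\<close>

lemma polytope_weak_sharp_minimum:
  fixes P :: "'a::euclidean_space set" and f :: "'a \<Rightarrow> real"
  assumes "polytope P" and f: "linear f" and min: "\<And>x. x \<in> P \<Longrightarrow> m \<le> f x"
    and v0: "v0 \<in> P" "f v0 = m"
  obtains \<kappa> where "\<kappa> > 0" "\<And>x. x \<in> P \<Longrightarrow> \<exists>p\<in>P. f p = m \<and> \<kappa> * norm (x - p) \<le> f x - m"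
proof -
  obtain W where W: "finite W" "P = convex hull W"
    using \<open>polytope P\<close> by (auto simp: polytope_def)
  have WP: "w \<in> P" if "w \<in> W" for w
    using W that by (simp add: hull_inc)
  \<comment> \<open>The least positive gap of \<open>f\<close> among the generators. The inserted 1
    keeps the set nonempty when all generators are minimizers; in \<open>R\<close> below it also
    makes the divisor positive.\<close>
  define \<delta> where "\<delta> = Min (insert 1 ((\<lambda>w. f w - m) ` {w \<in> W. f w > m}))"
  have "\<delta> > 0" unfolding \<delta>_def using W(1) by (subst Min_gr_iff) auto
  have gap: "\<delta> \<le> f w - m" if "w \<in> W" "f w \<noteq> m" for w
    using that W(1) min[OF WP[OF that(1)]] unfolding \<delta>_def by (intro Min_le) auto
  define R where "R = Max (insert 1 ((\<lambda>w. norm (w - v0)) ` W))"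
  have R1: "1 \<le> R" using W(1) by (simp add: R_def)
  have R: "norm (w - v0) \<le> R" if "w \<in> W" for w
    using W(1) that by (simp add: R_def)
  show thesis
  proof (rule that[of "\<delta> / R"])
    show "\<delta> / R > 0" using \<open>\<delta> > 0\<close> R1 by simp
    fix x assume "x \<in> P"
    then obtain u where u: "\<forall>w\<in>W. 0 \<le> u w" "sum u W = 1" and x: "(\<Sum>w\<in>W. u w *\<^sub>R w) = x"
      using W by (auto simp: convex_hull_finite)
    define p where "p = (\<Sum>w\<in>W. u w *\<^sub>R (if f w = m then w else v0))"
    have "p \<in> P"
      unfolding p_def using W u WP v0 by (intro convex_sum) (auto simp: convex_convex_hull)
    have "f p = (\<Sum>w\<in>W. u w * m)"
      unfolding p_def using v0 by (auto simp: linear_sum[OF f] linear_scale[OF f] intro!: sum.cong)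
    then have "f p = m" using u by (simp flip: sum_distrib_right)
    have "x - p = (\<Sum>w\<in>W. u w *\<^sub>R (if f w = m then 0 else w - v0))"
      unfolding p_def x[symmetric] sum_subtractf[symmetric]
      by (intro sum.cong) (auto simp: algebra_simps)
    also have "norm \<dots> \<le> (\<Sum>w\<in>W. u w * (if f w = m then 0 else R))"
      using u R by (intro sum_norm_le) (auto intro!: mult_left_mono)
    finally have "\<delta> / R * norm (x - p) \<le> \<delta> / R * (\<Sum>w\<in>W. u w * (if f w = m then 0 else R))"
      using \<open>\<delta> > 0\<close> R1 by (intro mult_left_mono) auto
    also have "\<dots> = (\<Sum>w\<in>W. u w * (if f w = m then 0 else \<delta>))"
      using R1 unfolding sum_distrib_left by (intro sum.cong) auto
    also have "\<dots> \<le> (\<Sum>w\<in>W. u w * (f w - m))"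
      using u gap by (intro sum_mono mult_left_mono) auto
    also have "\<dots> = (\<Sum>w\<in>W. u w * f w) - m"
      using u by (simp add: right_diff_distrib sum_subtractf flip: sum_distrib_right)
    also have "\<dots> = f x - m"
      unfolding x[symmetric] by (simp add: linear_sum[OF f] linear_scale[OF f])
    finally show "\<exists>p\<in>P. f p = m \<and> \<delta> / R * norm (x - p) \<le> f x - m"
      using \<open>p \<in> P\<close> \<open>f p = m\<close> by blast
  qed
qed

subsection \<open>The scalar product given by \<open>A\<close>\<close>

text \<open>The square root of \<open>A\<close>: it carries \<open>x \<bullet> (A *v y)\<close> to the Euclidean inner product.\<close>

definition root_map :: "real ^ 'm ^ 'm \<Rightarrow> real ^ 'm \<Rightarrow> real ^ 'm" where
  "root_map A x = (\<chi> i. sqrt (A $ i $ i) * x $ i)"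

lemma linear_root_map: "linear (root_map A)"
  by (rule linearI) (simp_all add: root_map_def vec_eq_iff algebra_simps)

lemma diagonal_matrix_vector_mult:
  assumes "diagonal_positive A"
  shows "(A *v x) $ i = A $ i $ i * x $ i"
proof -
  have "(\<Sum>j\<in>UNIV. A $ i $ j * x $ j) = (\<Sum>j\<in>UNIV. if j = i then A $ i $ i * x $ i else 0)"
    using assms by (intro sum.cong) (auto simp: diagonal_positive_def)
  then show ?thesis by (simp add: matrix_vector_mult_def)
qed

lemma inner_mult_eq_root_map:
  assumes "diagonal_positive A"
  shows "x \<bullet> (A *v y) = root_map A x \<bullet> root_map A y"
proof -
  have "sqrt (A $ i $ i) * sqrt (A $ i $ i) = A $ i $ i" for i
    using assms by (simp add: diagonal_positive_def less_imp_le)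
  then have "sqrt (A $ i $ i) * x $ i * (sqrt (A $ i $ i) * y $ i) = x $ i * (A $ i $ i * y $ i)" for i
    by (metis mult.assoc mult.left_commute)
  then show ?thesis
    by (simp only: inner_vec_def diagonal_matrix_vector_mult[OF assms] root_map_def vec_lambda_beta inner_real_def)
qed

lemma Anorm_eq_root_map: "diagonal_positive A \<Longrightarrow> Anorm A x = norm (root_map A x)"
  by (simp add: Anorm_def inner_mult_eq_root_map norm_eq_sqrt_inner)

lemma inj_root_map:
  assumes "diagonal_positive A" shows "inj (root_map A)"
proof (rule injI)
  fix x y assume "root_map A x = root_map A y"
  moreover have "sqrt (A $ i $ i) \<noteq> 0" for i
    using assms by (metis diagonal_positive_def less_irrefl real_sqrt_eq_0_iff)
  ultimately show "x = y" by (simp add: root_map_def vec_eq_iff)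
qed

subsection \<open>Normal cones and the exposed face\<close>

text \<open>Elements of a normal cone must lie in \<open>V\<close>, so a functional such as \<open>axis j 1\<close> has to be
  replaced by its Riesz representer in \<open>V\<close>.\<close>

lemma subspace_inner_representer:
  assumes V: "subspace V" and A: "diagonal_positive A"
  obtains n where "n \<in> V" "\<And>x. x \<in> V \<Longrightarrow> n \<bullet> (A *v x) = w \<bullet> (A *v x)"
proof -
  have W: "subspace (root_map A ` V)"
    using linear_subspace_image[OF linear_root_map V] .
  \<comment> \<open>The representer is the preimage of the orthogonal projection of
    \<open>root_map A w\<close> onto the image of \<open>V\<close>; \<open>z\<close> is the
    residue.\<close>
  obtain y z where yz: "y \<in> span (root_map A ` V)" "\<And>u. u \<in> span (root_map A ` V) \<Longrightarrow> orthogonal z u"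
    "root_map A w = y + z"
    using orthogonal_subspace_decomp_exists by metis
  obtain n where n: "n \<in> V" "y = root_map A n"
    using yz(1) W by (auto simp: span_eq_iff[THEN iffD2])
  show thesis
  proof (rule that[OF n(1)])
    fix x assume "x \<in> V"
    then have "z \<bullet> root_map A x = 0"
      using yz(2)[of "root_map A x"] by (auto simp: orthogonal_def span_base)
    then show "n \<bullet> (A *v x) = w \<bullet> (A *v x)"
      by (simp add: inner_mult_eq_root_map[OF A] yz(3) n(2)[symmetric] inner_add_left)
  qed
qed

lemma convex_normal_cone:
  assumes "subspace V" shows "convex (normal_cone V A K y)"
proof (cases "y \<in> K")
  case True
  show ?thesis
    unfolding convex_def normal_cone_def using True assms
    by (auto simp: inner_add_left subspace_add subspace_scale add_nonpos_nonpos mult_nonneg_nonpos)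
qed (simp add: normal_cone_def)

text \<open>The segment from \<open>v\<close> to \<open>u\<close> can be prolonged beyond
  \<open>u\<close> inside the cone. Pairing with \<open>x - y\<close> is nonpositive on the cone and
  zero at \<open>u\<close>, so a negative value at \<open>v\<close> would become positive at the
  prolonged point.\<close>

lemma rel_interior_normal_cone_orthogonal:
  assumes V: "subspace V" and u: "u \<in> rel_interior (normal_cone V A K y)"
    and x: "x \<in> K" "u \<bullet> (A *v (x - y)) = 0" and v: "v \<in> normal_cone V A K y"
  shows "v \<bullet> (A *v (x - y)) = 0"
proof -
  have "normal_cone V A K y \<noteq> {}" using v by auto
  then obtain e where "e > 1" and e: "(1 - e) *\<^sub>R v + e *\<^sub>R u \<in> normal_cone V A K y"
    using convex_rel_interior_iff[OF convex_normal_cone[OF V]] u v by blast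
  have "((1 - e) *\<^sub>R v + e *\<^sub>R u) \<bullet> (A *v (x - y)) \<le> 0" "v \<bullet> (A *v (x - y)) \<le> 0"
    using e v x by (auto simp: normal_cone_def split: if_splits)
  then have "(1 - e) * (v \<bullet> (A *v (x - y))) \<le> 0" "v \<bullet> (A *v (x - y)) \<le> 0"
    using x by (simp_all add: inner_add_left)
  then show ?thesis using \<open>e > 1\<close> by (simp add: mult_le_0_iff)
qed

section \<open>The polytope \<open>C\<close> and its face \<open>F\<close>\<close>

lemma inner_axis_mult:
  assumes "diagonal_positive A"
  shows "axis j 1 \<bullet> (A *v x) = A $ j $ j * x $ j"
  by (simp add: inner_axis' diagonal_matrix_vector_mult[OF assms])

text \<open>Since \<open>A\<close> is diagonal and positive, each pair of constraints confines one
  coordinate to a bounded interval, so the polyhedron lies in a box.\<close>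

lemma polytope_Cset:
  assumes V: "subspace V" and A: "diagonal_positive A"
  shows "polytope (Cset V A cm cp)"
proof -
  have lin: "axis j 1 \<bullet> (A *v x) = (A $ j $ j *\<^sub>R axis j 1) \<bullet> x" for j and x :: "real ^ 'a"
    by (simp add: inner_axis' diagonal_matrix_vector_mult[OF A])
  have "Cset V A cm cp = (\<Inter>j. V \<inter> {x. (A $ j $ j *\<^sub>R axis j 1) \<bullet> x \<ge> cm j} \<inter> {x. (A $ j $ j *\<^sub>R axis j 1) \<bullet> x \<le> cp j})"
    by (auto simp: Cset_def halfsp_def bnd_def lin)
  moreover have "polyhedron V"
    using V affine_imp_polyhedron subspace_imp_affine by blast
  ultimately have "polyhedron (Cset V A cm cp)"
    by (auto intro!: polyhedron_Inter polyhedron_Int polyhedron_halfspace_le polyhedron_halfspace_ge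
        simp del: inner_scaleR_left)
  moreover have "Cset V A cm cp \<subseteq> cbox (\<chi> j. cm j / A $ j $ j) (\<chi> j. cp j / A $ j $ j)"
    using A by (auto simp: Cset_def halfsp_def bnd_def mem_box_cart inner_axis_mult[OF A]
        diagonal_positive_def field_simps)
  ultimately show ?thesis
    by (meson bounded_cbox bounded_subset polytope_eq_bounded_polyhedron)
qed

lemma Fset_eq_face:
  assumes "\<And>i. i \<le> M \<Longrightarrow> I i \<subseteq> {-1, 1} \<times> UNIV" and "Fset V A cm cp I M \<subseteq> Cset V A cm cp"
  shows "Fset V A cm cp I M = Cset V A cm cp \<inter> hyper_inter V A cm cp (I 0)"
proof -
  have "Cset V A cm cp \<subseteq> halfsp V A cm cp \<alpha> j" if "i \<in> {1..M}" "(\<alpha>, j) \<in> I i" for i \<alpha> j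
  proof -
    have "\<alpha> \<in> {-1, 1}" using assms(1)[of i] that by auto
    then show ?thesis by (auto simp: Cset_def)
  qed
  then have "Cset V A cm cp \<inter> hyper_inter V A cm cp (I 0) \<subseteq> Fset V A cm cp I M"
    unfolding Fset_def by blast
  moreover have "Fset V A cm cp I M \<subseteq> hyper_inter V A cm cp (I 0)"
    by (simp add: Fset_def)
  ultimately show ?thesis using assms(2) by blast
qed

text \<open>Both inclusions prolong a segment beyond a relative interior point. Inside
  \<open>F\<close>, prolonging beyond \<open>y\<close> forces the pairing of \<open>u\<close> with
  \<open>x - y\<close> to vanish. Inside the normal cone, prolonging beyond \<open>u\<close> shows
  that the constraints in \<open>I 0\<close> are active wherever that pairing vanishes.\<close>

lemma Fset_exposed:
  assumes V: "subspace V" and A: "diagonal_positive A" and I: "I 0 \<subseteq> {-1, 1} \<times> UNIV"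
    and F: "F = Cset V A cm cp \<inter> hyper_inter V A cm cp (I 0)"
    and y: "y \<in> rel_interior F" and u: "u \<in> rel_interior (normal_cone V A (Cset V A cm cp) y)"
  shows "F = {x \<in> Cset V A cm cp. u \<bullet> (A *v (x - y)) = 0}"
proof (intro set_eqI iffI)
  let ?C = "Cset V A cm cp"
  have yF: "y \<in> F" using y rel_interior_subset by blast
  then have yC: "y \<in> ?C" and yH: "y \<in> hyper_inter V A cm cp (I 0)" using F by auto
  have CV: "?C \<subseteq> V" by (auto simp: Cset_def halfsp_def)
  {
    fix x assume "x \<in> F"
    have "convex F"
      unfolding F hyper_inter_def hypersp_def using V polytope_imp_convex[OF polytope_Cset[OF V A]]
      by (intro convex_Int convex_INT)
         (auto simp: convex_def subspace_add subspace_scale matrix_vector_right_distrib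
            matrix_vector_mult_scaleR inner_add_right simp flip: distrib_right
            intro: subspace_imp_convex)
    then obtain e where "e > 1" and e: "(1 - e) *\<^sub>R x + e *\<^sub>R y \<in> F"
      using convex_rel_interior_iff y \<open>x \<in> F\<close> by blast
    have nc: "u \<bullet> (A *v (\<xi> - y)) \<le> 0" if "\<xi> \<in> ?C" for \<xi>
      using u rel_interior_subset[of "normal_cone V A ?C y"] yC that by (auto simp: normal_cone_def)
    have "(1 - e) *\<^sub>R x + e *\<^sub>R y - y = (1 - e) *\<^sub>R (x - y)" by (simp add: algebra_simps)
    then have "(1 - e) * (u \<bullet> (A *v (x - y))) \<le> 0" "u \<bullet> (A *v (x - y)) \<le> 0"
      using nc[of "(1 - e) *\<^sub>R x + e *\<^sub>R y"] nc[of x] e \<open>x \<in> F\<close> F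
      by (auto simp: matrix_vector_mult_scaleR)
    then have "u \<bullet> (A *v (x - y)) = 0" using \<open>e > 1\<close> by (simp add: mult_le_0_iff)
    then show "x \<in> {x \<in> ?C. u \<bullet> (A *v (x - y)) = 0}" using \<open>x \<in> F\<close> F by auto
  next
    fix x assume "x \<in> {x \<in> ?C. u \<bullet> (A *v (x - y)) = 0}"
    then have x: "x \<in> ?C" "u \<bullet> (A *v (x - y)) = 0" by auto
    have "x \<in> hypersp V A cm cp \<alpha> j" if "(\<alpha>, j) \<in> I 0" for \<alpha> j
    proof -
      have \<alpha>: "\<alpha> = -1 \<or> \<alpha> = 1" using I that by auto
      obtain n where n: "n \<in> V" "\<And>x. x \<in> V \<Longrightarrow> n \<bullet> (A *v x) = axis j 1 \<bullet> (A *v x)"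
        using subspace_inner_representer[OF V A] by blast
      have yj: "axis j 1 \<bullet> (A *v y) = bnd cm cp \<alpha> j"
        using yH that by (auto simp: hyper_inter_def hypersp_def)
      have "of_int \<alpha> *\<^sub>R n \<bullet> (A *v (\<xi> - y)) = of_int \<alpha> * (axis j 1 \<bullet> (A *v \<xi>) - bnd cm cp \<alpha> j)"
        if "\<xi> \<in> ?C" for \<xi>
      proof -
        have "n \<bullet> (A *v (\<xi> - y)) = axis j 1 \<bullet> (A *v (\<xi> - y))"
          using n(2) that CV yC V by (simp add: subsetD subspace_diff)
        then show ?thesis by (simp only: inner_scaleR_left) (simp add: matrix_vector_mult_diff_distrib inner_diff_right yj)
      qed
      note nj = this
      \<comment> \<open>The factor \<alpha> makes the representer of a constraint active at
        \<open>y\<close> point out of \<open>C\<close>. Orthogonality to \<open>x - y\<close> then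
        says that the constraint is active at \<open>x\<close> too.\<close>
      have "of_int \<alpha> *\<^sub>R n \<in> normal_cone V A ?C y"
        using yC n(1) V nj \<alpha> by (auto simp: normal_cone_def subspace_scale Cset_def halfsp_def)
      from rel_interior_normal_cone_orthogonal[OF V u x this]
      have "axis j 1 \<bullet> (A *v x) = bnd cm cp \<alpha> j"
        using nj[OF x(1)] \<alpha> by auto
      then show ?thesis using x CV by (auto simp: hypersp_def)
    qed
    then show "x \<in> F" using x CV by (auto simp: F hyper_inter_def)
  }
qed

text \<open>Weak sharpness is a Euclidean statement, so it is applied to the image of
  \<open>C\<close> under \<open>root_map A\<close> and pulled back. Any \<open>q\<close> in
  \<open>F\<close> can serve as base point, because the linear function is constant on
  \<open>F\<close>.\<close>

lemma face_sharp:
  assumes V: "subspace V" and A: "diagonal_positive A" and "y \<in> F"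
    and F: "F = {x \<in> Cset V A cm cp. u \<bullet> (A *v (x - y)) = 0}"
    and min: "\<And>x. x \<in> Cset V A cm cp \<Longrightarrow> u \<bullet> (A *v (x - y)) \<ge> 0"
  obtains \<kappa> where "\<kappa> > 0"
    "\<And>x q. x \<in> Cset V A cm cp \<Longrightarrow> q \<in> F \<Longrightarrow> \<exists>p\<in>F. \<kappa> * Anorm A (x - p) \<le> u \<bullet> (A *v (x - q))"
proof -
  let ?C = "Cset V A cm cp" and ?B = "root_map A"
  define m where "m = ?B u \<bullet> ?B y"
  have diff: "u \<bullet> (A *v (x - y)) = ?B u \<bullet> ?B x - m" for x
    by (simp add: inner_mult_eq_root_map[OF A] linear_diff[OF linear_root_map] inner_diff_right m_def)
  have "polytope (?B ` ?C)"
    using polytope_Cset[OF V A] linear_root_map by (metis polytope_linear_image)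
  moreover have "linear (\<lambda>x. ?B u \<bullet> x)"
    by (simp add: linear_iff inner_add_right)
  ultimately obtain \<kappa> where "\<kappa> > 0"
    and \<kappa>: "\<And>x. x \<in> ?B ` ?C \<Longrightarrow> \<exists>p\<in>?B ` ?C. ?B u \<bullet> p = m \<and> \<kappa> * norm (x - p) \<le> ?B u \<bullet> x - m"
  proof (rule polytope_weak_sharp_minimum[of _ _ m "?B y"])
    show "m \<le> ?B u \<bullet> x" if "x \<in> ?B ` ?C" for x using that min diff by auto
    show "?B y \<in> ?B ` ?C" "?B u \<bullet> ?B y = m" using \<open>y \<in> F\<close> F by (auto simp: m_def)
  qed blast
  show thesis
  proof (rule that[OF \<open>\<kappa> > 0\<close>])
    fix x q assume x: "x \<in> ?C" and "q \<in> F"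
    have "u \<bullet> (A *v (x - q)) = ?B u \<bullet> ?B x - m"
      using \<open>q \<in> F\<close> F diff[of q] diff[of x] 
      by (simp add: matrix_vector_mult_diff_distrib inner_diff_right)
    moreover obtain p where "p \<in> ?C" "?B u \<bullet> ?B p = m" "\<kappa> * norm (?B x - ?B p) \<le> ?B u \<bullet> ?B x - m"
      using \<kappa>[of "?B x"] x by auto
    ultimately show "\<exists>p\<in>F. \<kappa> * Anorm A (x - p) \<le> u \<bullet> (A *v (x - q))"
      using F diff by (intro bexI[of _ p]) (auto simp: Anorm_eq_root_map[OF A] linear_diff[OF linear_root_map])
  qed
qed

text \<open>Split \<open>x - y\<close> into \<open>x - p\<close> and \<open>p - y\<close>, with
  \<open>p\<close> from the growth estimate. Cauchy-Schwarz and the bound on \<xi> control the first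
  part, normality of \<xi> to \<open>F\<close> the second; together they do not exceed the pairing
  of \<open>c1\<close> with \<open>x - y\<close>.\<close>

lemma face_drift_subset_normal_cone:
  assumes V: "subspace V" and A: "diagonal_positive A" and "c1 \<in> V" and "F \<subseteq> C"
    and sharp: "\<And>x q. x \<in> C \<Longrightarrow> q \<in> F \<Longrightarrow> \<exists>p\<in>F. \<kappa> * Anorm A (x - p) \<le> c1 \<bullet> (A *v (x - q))"
    and "y \<in> F"
  shows "translate (Aball V A \<kappa> \<inter> normal_cone V A F y) (- c1) \<subseteq> normal_cone V A C y"
proof
  fix v assume "v \<in> translate (Aball V A \<kappa> \<inter> normal_cone V A F y) (- c1)"
  then obtain \<xi> where v: "v = \<xi> - c1" and "\<xi> \<in> V" "Anorm A \<xi> \<le> \<kappa>"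
    and \<xi>: "\<And>p. p \<in> F \<Longrightarrow> \<xi> \<bullet> (A *v (p - y)) \<le> 0"
    using \<open>y \<in> F\<close> by (auto simp: translate_def Aball_def normal_cone_def)
  have "v \<bullet> (A *v (x - y)) \<le> 0" if x: "x \<in> C" for x
  proof -
    obtain p where "p \<in> F" and p: "\<kappa> * Anorm A (x - p) \<le> c1 \<bullet> (A *v (x - y))"
      using sharp[OF x \<open>y \<in> F\<close>] by blast
    have "\<xi> \<bullet> (A *v (x - p)) \<le> Anorm A \<xi> * Anorm A (x - p)"
      by (simp add: inner_mult_eq_root_map[OF A] Anorm_eq_root_map[OF A] norm_cauchy_schwarz)
    also have "\<dots> \<le> \<kappa> * Anorm A (x - p)"
      using \<open>Anorm A \<xi> \<le> \<kappa>\<close> by (intro mult_right_mono) (simp_all add: Anorm_eq_root_map[OF A])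
    finally have "\<xi> \<bullet> (A *v (x - p)) + \<xi> \<bullet> (A *v (p - y)) \<le> c1 \<bullet> (A *v (x - y))"
      using p \<xi>[OF \<open>p \<in> F\<close>] by linarith
    then show ?thesis
      by (simp add: v matrix_vector_mult_diff_distrib inner_diff_left inner_diff_right)
  qed
  then show "v \<in> normal_cone V A C y"
    using V v \<open>\<xi> \<in> V\<close> \<open>c1 \<in> V\<close> \<open>y \<in> F\<close> \<open>F \<subseteq> C\<close> by (auto simp: normal_cone_def subspace_diff)
qed

subsection \<open>Finite-time convergence\<close>

text \<open>Off \<open>N\<close> the squared norm of \<open>w\<close> has derivative at most
  \<open>- 2 * k\<close>, so adding \<open>2 * k * u\<close> gives a function \<open>h\<close> with
  nonpositive derivative. The bound \<open>R\<close> makes squaring Lipschitz along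
  \<open>w\<close>, so \<open>h\<close> inherits absolute continuity from \<open>y\<close>.\<close>

lemma root_map_sq_dist_decrease:
  fixes y :: "real \<Rightarrow> real ^ 'm" and A :: "real ^ 'm ^ 'm" and q c1 :: "real ^ 'm"
  defines "w \<equiv> \<lambda>u. root_map A (y u - u *\<^sub>R c1 - q)"
  assumes ac: "abs_cont_on_interval s t y" and "s \<le> t" and N: "N \<in> null_sets lebesgue"
    and bdd: "\<And>u. u \<in> {s..t} \<Longrightarrow> norm (w u) \<le> R"
    and deriv: "\<And>u. u \<in> {s..t} - N \<Longrightarrow>
      \<exists>v. (y has_vector_derivative v) (at u) \<and> root_map A v \<bullet> w u \<le> 0"
    and gap: "\<And>u. u \<in> {s..t} \<Longrightarrow> k \<le> root_map A c1 \<bullet> w u"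
  shows "(norm (w t))\<^sup>2 \<le> (norm (w s))\<^sup>2 - 2 * k * (t - s)"
proof -
  define h where "h = (\<lambda>u. w u \<bullet> w u + 2 * k * u)"
  have bl: "bounded_linear (root_map A)"
    using linear_root_map linear_conv_bounded_linear by blast
  obtain B where "B \<ge> 0" and B: "\<And>x. norm (root_map A x) \<le> norm x * B"
    using bounded_linear.nonneg_bounded[OF bl] by metis
  have "abs_cont_on_interval s t h"
  proof (rule abs_cont_on_interval_dominated[OF ac])
    fix l r assume lr: "s \<le> l" "l \<le> r" "r \<le> t"
    have R: "norm (w l) \<le> R" "norm (w r) \<le> R" using bdd lr by auto
    have "w r - w l = root_map A (y r - y l - (r - l) *\<^sub>R c1)"
      unfolding w_def linear_diff[OF linear_root_map, symmetric] by (simp add: algebra_simps)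
    then have "norm (w r - w l) \<le> norm (y r - y l - (r - l) *\<^sub>R c1) * B"
      using B by simp
    also have "\<dots> \<le> (norm (y r - y l) + (r - l) * norm c1) * B"
      using \<open>B \<ge> 0\<close> lr by (intro mult_right_mono order_trans[OF norm_triangle_ineq4]) auto
    finally have d: "norm (w r - w l) \<le> (norm (y r - y l) + (r - l) * norm c1) * B" .
    have "w r \<bullet> w r - w l \<bullet> w l = (w r - w l) \<bullet> (w r + w l)"
      by (simp add: algebra_simps inner_commute)
    then have "\<bar>w r \<bullet> w r - w l \<bullet> w l\<bar> \<le> norm (w r - w l) * norm (w r + w l)"
      using Cauchy_Schwarz_ineq2 by metis
    also have "\<dots> \<le> (norm (y r - y l) + (r - l) * norm c1) * B * (2 * R)"
      using d R norm_triangle_ineq[of "w r" "w l"] \<open>B \<ge> 0\<close> lr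
      by (intro mult_mono) auto
    finally have 1: "\<bar>w r \<bullet> w r - w l \<bullet> w l\<bar> \<le> (norm (y r - y l) + (r - l) * norm c1) * (B * (2 * R))"
      by (simp add: mult.assoc)
    define b where "b = B * (2 * R)"
    have "R \<ge> 0" using R(1) norm_ge_zero[of "w l"] by linarith
    then have "b \<ge> 0" using \<open>B \<ge> 0\<close> by (simp add: b_def)
    have "norm (h r - h l) \<le> \<bar>w r \<bullet> w r - w l \<bullet> w l\<bar> + \<bar>2 * k * (r - l)\<bar>"
      unfolding h_def real_norm_def by (simp add: algebra_simps abs_triangle_ineq4)
    also have "\<dots> \<le> (norm (y r - y l) + (r - l) * norm c1) * b + \<bar>2 * k\<bar> * (r - l)"
      using 1 lr by (simp add: abs_mult b_def)
    also have "\<dots> \<le> (b + norm c1 * b + \<bar>2 * k\<bar>) * (norm (y r - y l) + (r - l))"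
    proof -
      have "0 \<le> b * (r - l) + norm c1 * b * norm (y r - y l) + \<bar>2 * k\<bar> * norm (y r - y l)"
        using lr \<open>b \<ge> 0\<close> by (intro add_nonneg_nonneg mult_nonneg_nonneg) auto
      then show ?thesis by (simp add: algebra_simps)
    qed
    finally show "norm (h r - h l) \<le> (b + norm c1 * b + \<bar>2 * k\<bar>) * (norm (y r - y l) + (r - l))" .
  qed
  moreover have "\<exists>D\<le>0. (h has_real_derivative D) (at u)" if u: "u \<in> {s..t} - N" for u
  proof -
    obtain v where v: "(y has_vector_derivative v) (at u)" "root_map A v \<bullet> w u \<le> 0"
      using deriv[OF u] by blast
    have "((\<lambda>u. y u - u *\<^sub>R c1 - q) has_vector_derivative (v - c1)) (at u)"
      by (auto intro!: derivative_eq_intros v(1))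
    then have "((\<lambda>u. w u) has_vector_derivative root_map A (v - c1)) (at u)"
      unfolding w_def by (rule bounded_linear.has_vector_derivative[OF bl])
    then have wd: "((\<lambda>u. w u) has_derivative (\<lambda>x. x *\<^sub>R root_map A (v - c1))) (at u)"
      by (simp add: has_vector_derivative_def)
    have "(h has_real_derivative 2 * (root_map A (v - c1) \<bullet> w u) + 2 * k) (at u)"
      unfolding h_def has_field_derivative_def
      by (rule derivative_eq_intros wd refl)+ (auto simp: fun_eq_iff algebra_simps inner_commute)
    moreover have "2 * (root_map A (v - c1) \<bullet> w u) + 2 * k \<le> 0"
      using v(2) gap[of u] u by (simp add: linear_diff[OF linear_root_map] inner_diff_left)
    ultimately show ?thesis by blast
  qed
  ultimately have "h t \<le> h s"
    using abs_cont_deriv_nonpos_imp_le[OF _ \<open>s \<le> t\<close> N] by blast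
  then show ?thesis by (simp add: h_def power2_norm_eq_inner algebra_simps)
qed

text \<open>After a time \<open>D s / \<kappa>\<close> the value \<open>D s\<close> is at least halved, and these times form a
  geometric series.\<close>

lemma finite_time_extinction:
  fixes D :: "real \<Rightarrow> real"
  assumes "\<kappa> > 0" and D0: "\<And>t. t \<ge> 0 \<Longrightarrow> D t \<ge> 0"
    and dec: "\<And>s t. 0 \<le> s \<Longrightarrow> s \<le> t \<Longrightarrow> (D t)\<^sup>2 \<le> (D s)\<^sup>2 - 2 * \<kappa> * (t - s) * D t"
  shows "\<exists>T>0. \<forall>t\<ge>T. D t = 0"
\<comment> \<open>The sum of the whole geometric series of halving times; the added 1 keeps it
  positive when \<open>D 0 = 0\<close>.\<close>
proof (intro exI[of _ "2 * D 0 / \<kappa> + 1"] conjI allI impI)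
  show "2 * D 0 / \<kappa> + 1 > 0" using \<open>\<kappa> > 0\<close> D0[of 0] by (simp add: add_nonneg_pos)
  \<comment> \<open>The time threshold is the partial sum of \<open>D 0 / 2 ^ k / \<kappa>\<close>
    over \<open>k < n\<close>.\<close>
  have halve: "D t \<le> D 0 / 2 ^ n" if "(2 - 2 / 2 ^ n) * D 0 / \<kappa> \<le> t" "0 \<le> t" for n t
    using that
  proof (induction n arbitrary: t)
    case 0
    then have "(D t)\<^sup>2 \<le> (D 0)\<^sup>2 - 2 * \<kappa> * t * D t" "2 * \<kappa> * t * D t \<ge> 0"
      using dec[of 0 t] D0[of t] \<open>\<kappa> > 0\<close> by auto
    then have "(D t)\<^sup>2 \<le> (D 0)\<^sup>2" by linarith
    then show ?case using power2_le_imp_le[of "D t" "D 0"] D0[of 0] by simp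
  next
    case (Suc n)
    define q where "q = D 0 / 2 ^ n"
    define s where "s = (2 - 2 / 2 ^ n) * D 0 / \<kappa>"
    have "q \<ge> 0" using D0[of 0] by (simp add: q_def)
    have "(2::real) / 2 ^ n \<le> 2" by (simp add: divide_le_eq)
    then have "0 \<le> s" using \<open>\<kappa> > 0\<close> D0[of 0] by (simp add: s_def)
    have ts: "s + q / \<kappa> \<le> t"
    proof -
      have "s + q / \<kappa> = (2 - 2 / 2 ^ Suc n) * D 0 / \<kappa>"
        using \<open>\<kappa> > 0\<close> by (simp add: s_def q_def field_simps)
      then show ?thesis using Suc.prems(1) by simp
    qed
    then have "s \<le> t" using \<open>q \<ge> 0\<close> \<open>\<kappa> > 0\<close> by (smt (verit) divide_nonneg_pos)
    have "D s \<le> q" unfolding q_def using Suc.IH[of s] \<open>0 \<le> s\<close> by (simp add: s_def)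
    show ?case
    proof (rule ccontr)
      \<comment> \<open>If \<open>D t\<close> exceeded \<open>q / 2\<close>, the decrease
        \<open>2 * \<kappa> * (t - s) * D t\<close> would be at least \<open>q * q\<close>, hence at
        least the square of \<open>D s\<close>. Nothing would be left for the positive square of
        \<open>D t\<close>.\<close>
      assume "\<not> ?case"
      then have "D t > q / 2" by (simp add: q_def mult.commute)
      have "q \<le> \<kappa> * (t - s)" using ts \<open>\<kappa> > 0\<close> by (simp add: field_simps)
      then have "q * D t \<le> \<kappa> * (t - s) * D t"
        using \<open>D t > q / 2\<close> \<open>q \<ge> 0\<close> by (intro mult_right_mono) auto
      moreover have "q * q \<le> 2 * (q * D t)"
        using \<open>D t > q / 2\<close> \<open>q \<ge> 0\<close> mult_left_mono[of q "2 * D t" q] by simp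
      moreover have "(D s)\<^sup>2 \<le> q * q"
        using \<open>D s \<le> q\<close> D0[OF \<open>0 \<le> s\<close>] by (simp add: power2_eq_square mult_mono)
      moreover have "(D t)\<^sup>2 > 0" using \<open>D t > q / 2\<close> \<open>q \<ge> 0\<close> by simp
      ultimately show False using dec[OF \<open>0 \<le> s\<close> \<open>s \<le> t\<close>] by (simp add: mult.assoc)
    qed
  qed
  fix t assume t: "2 * D 0 / \<kappa> + 1 \<le> t"
  have "0 \<le> 2 * D 0 / \<kappa>" using \<open>\<kappa> > 0\<close> D0[of 0] by simp
  then have "0 \<le> t" using t by linarith
  have "D t \<le> D 0 / 2 ^ n" for n
  proof (rule halve[OF _ \<open>0 \<le> t\<close>])
    have "(2 - 2 / 2 ^ n) * (D 0 / \<kappa>) \<le> 2 * (D 0 / \<kappa>)"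
      using \<open>0 \<le> 2 * D 0 / \<kappa>\<close> by (intro mult_right_mono) auto
    then show "(2 - 2 / 2 ^ n) * D 0 / \<kappa> \<le> t" using t by simp
  qed
  moreover have "(\<lambda>n. D 0 / 2 ^ n) \<longlonglongrightarrow> 0"
    by (rule LIMSEQ_divide_realpow_zero) simp
  ultimately have "D t \<le> 0" by (intro LIMSEQ_le_const) auto
  then show "D t = 0" using D0[OF \<open>0 \<le> t\<close>] by simp
qed

text \<open>In the moving frame \<open>z = y - c\<close> the constraint set is the fixed
  \<open>C\<close>, and the drift is \<open>- c1\<close>. The growth estimate makes this drift
  approach every point of \<open>F\<close> at a rate governed by the distance \<open>D\<close> to
  \<open>F\<close>.\<close>

lemma sweeping_reaches_face:
  fixes y :: "real \<Rightarrow> real ^ 'm"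
  assumes A: "diagonal_positive A" and "bounded C" "compact F" "F \<noteq> {}" "F \<subseteq> C" "\<kappa> > 0"
    and c: "\<And>t. t \<ge> 0 \<Longrightarrow> c t = c0 + t *\<^sub>R c1"
    and sharp: "\<And>x q. x \<in> C \<Longrightarrow> q \<in> F \<Longrightarrow> \<exists>p\<in>F. \<kappa> * Anorm A (x - p) \<le> c1 \<bullet> (A *v (x - q))"
    and sol: "sweeping_solution V A (\<lambda>t. translate C (c t)) y"
  shows "\<exists>T>0. \<forall>t\<ge>T. y t \<in> translate F (c t)"
proof -
  let ?B = "root_map A"
  define z where "z = (\<lambda>t. y t - c t)"
  define D where "D = (\<lambda>t. infdist (?B (z t)) (?B ` F))"
  have zC: "z t \<in> C" if "t \<ge> 0" for t
    using sol that unfolding sweeping_solution_def translate_def z_def by fastforce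
  have cont: "continuous_on S ?B" for S
    using linear_root_map linear_conv_bounded_linear linear_continuous_on by blast
  have BF: "compact (?B ` F)" "?B ` F \<noteq> {}"
    using \<open>compact F\<close> \<open>F \<noteq> {}\<close> compact_continuous_image[OF cont] by auto
  have ptwise: "\<kappa> * D t \<le> ?B c1 \<bullet> ?B (z t - q)" if "t \<ge> 0" "q \<in> F" for t q
  proof -
    obtain p where "p \<in> F" "\<kappa> * norm (?B (z t) - ?B p) \<le> ?B c1 \<bullet> ?B (z t - q)"
      using sharp[OF zC[OF \<open>t \<ge> 0\<close>] \<open>q \<in> F\<close>]
      by (auto simp: Anorm_eq_root_map[OF A] inner_mult_eq_root_map[OF A] linear_diff[OF linear_root_map])
    moreover have "D t \<le> norm (?B (z t) - ?B p)"
      unfolding D_def dist_norm[symmetric] using \<open>p \<in> F\<close> by (intro infdist_le) auto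
    ultimately show ?thesis using \<open>\<kappa> > 0\<close> by (meson mult_le_cancel_left_pos order_trans)
  qed
  define P where "P = (\<lambda>t. t \<ge> 0 \<longrightarrow>
    (\<exists>v. (y has_vector_derivative v) (at t) \<and> - v \<in> normal_cone V A (translate C (c t)) (y t)))"
  have "AE t in lebesgue. P t"
    using sol by (simp add: sweeping_solution_def P_def)
  then obtain N where N: "N \<in> null_sets lebesgue" and "{t \<in> space lebesgue. \<not> P t} \<subseteq> N"
    unfolding eventually_ae_filter by (elim bexE) (rule that)
  then have "P t" if "t \<notin> N" for t
    using that by auto
  then have vel: "\<exists>v. (y has_vector_derivative v) (at t) \<and> - v \<in> normal_cone V A (translate C (c t)) (y t)"
    if "t \<notin> N" "t \<ge> 0" for t
    using that by (simp add: P_def)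
  obtain R where R: "\<And>x. x \<in> ?B ` C \<Longrightarrow> norm x \<le> R"
    using bounded_linear_image[OF \<open>bounded C\<close>, of ?B] linear_root_map linear_conv_bounded_linear
    unfolding bounded_iff by blast
  \<comment> \<open>The lower bound \<open>r\<close> for the distance stays a parameter: it is 0 at
    first, and \<open>D t\<close> once monotonicity is known.\<close>
  have step: "(norm (?B (z t - p)))\<^sup>2 \<le> (norm (?B (z s - p)))\<^sup>2 - 2 * (\<kappa> * r) * (t - s)"
    if st: "0 \<le> s" "s \<le> t" and p: "p \<in> F" and r: "\<And>u. u \<in> {s..t} \<Longrightarrow> r \<le> D u" for s t p r
  proof -
    have z: "z u - p = y u - u *\<^sub>R c1 - (c0 + p)" if "u \<in> {s..t}" for u
      using that st by (simp add: z_def c)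
    have "abs_cont_on_interval 0 t y"
      using sol st by (auto simp: sweeping_solution_def loc_abs_cont_def)
    then have "abs_cont_on_interval s t y"
      by (rule abs_cont_on_subinterval) (use st in auto)
    then have "(norm (?B (y t - t *\<^sub>R c1 - (c0 + p))))\<^sup>2
        \<le> (norm (?B (y s - s *\<^sub>R c1 - (c0 + p))))\<^sup>2 - 2 * (\<kappa> * r) * (t - s)"
    proof (rule root_map_sq_dist_decrease[OF _ \<open>s \<le> t\<close> N])
      fix u assume u: "u \<in> {s..t}"
      have "norm (?B (z u) - ?B p) \<le> R + R"
        using R[of "?B (z u)"] R[of "?B p"] zC[of u] u st p \<open>F \<subseteq> C\<close>
        by (intro order_trans[OF norm_triangle_ineq4] add_mono) auto
      then show "norm (?B (y u - u *\<^sub>R c1 - (c0 + p))) \<le> R + R"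
        by (simp only: linear_diff[OF linear_root_map, symmetric] z[OF u])
      have "\<kappa> * r \<le> \<kappa> * D u" using r[OF u] \<open>\<kappa> > 0\<close> by simp
      also have "\<dots> \<le> ?B c1 \<bullet> ?B (z u - p)" using ptwise u st p by auto
      finally show "\<kappa> * r \<le> ?B c1 \<bullet> ?B (y u - u *\<^sub>R c1 - (c0 + p))" by (simp only: z[OF u])
    next
      fix u assume u: "u \<in> {s..t} - N"
      then obtain v where v: "(y has_vector_derivative v) (at u)"
        "- v \<in> normal_cone V A (translate C (c u)) (y u)"
        using vel[of u] st by auto
      \<comment> \<open>The normal cone inequality is tested at the point of the moving set that
        corresponds to \<open>p\<close>.\<close>
      have "p + c u \<in> translate C (c u)" using p \<open>F \<subseteq> C\<close> by (auto simp: translate_def)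
      then have "- v \<bullet> (A *v (p + c u - y u)) \<le> 0"
        using v(2) by (auto simp: normal_cone_def split: if_splits)
      moreover have "p + c u - y u = - (z u - p)" by (simp add: z_def)
      ultimately have "?B v \<bullet> ?B (z u - p) \<le> 0"
        by (simp add: inner_mult_eq_root_map[OF A] linear_neg[OF linear_root_map] linear_diff[OF linear_root_map] inner_diff_right)
      then show "\<exists>v. (y has_vector_derivative v) (at u) \<and> ?B v \<bullet> ?B (y u - u *\<^sub>R c1 - (c0 + p)) \<le> 0"
        using v(1) u by (subst z[symmetric]) auto
    qed
    then show ?thesis using st by (simp only: z atLeastAtMost_iff order_refl)
  qed
  have dist_step: "(D t)\<^sup>2 \<le> (D s)\<^sup>2 - 2 * (\<kappa> * r) * (t - s)"
    if st: "0 \<le> s" "s \<le> t" and r: "\<And>u. u \<in> {s..t} \<Longrightarrow> r \<le> D u" for s t r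
  proof -
    \<comment> \<open>The comparison point is a projection at the initial time: the estimate is
      exact at \<open>s\<close>, and at \<open>t\<close> any point of \<open>F\<close> bounds the
      distance from above.\<close>
    obtain p where p: "p \<in> F" "D s = dist (?B (z s)) (?B p)"
      using infdist_attains_inf[OF compact_imp_closed[OF BF(1)] BF(2), of "?B (z s)"]
      by (auto simp: D_def)
    have "D t \<le> norm (?B (z t - p))"
      unfolding D_def linear_diff[OF linear_root_map] dist_norm[symmetric]
      using p by (intro infdist_le) auto
    then have "(D t)\<^sup>2 \<le> (norm (?B (z t - p)))\<^sup>2"
      by (intro power_mono) (auto simp: D_def infdist_nonneg)
    also have "\<dots> \<le> (norm (?B (z s - p)))\<^sup>2 - 2 * (\<kappa> * r) * (t - s)"
      by (rule step[OF st p(1) r])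
    finally show ?thesis
      by (simp add: p(2) dist_norm linear_diff[OF linear_root_map])
  qed
  have nonneg: "D t \<ge> 0" for t by (simp add: D_def infdist_nonneg)
  \<comment> \<open>Monotonicity makes \<open>D t\<close> the least value of \<open>D\<close> on the
    interval from \<open>s\<close> to \<open>t\<close>, hence an admissible \<open>r\<close> in the
    next step.\<close>
  have mono: "D t \<le> D s" if "0 \<le> s" "s \<le> t" for s t
    using dist_step[OF that, of 0] nonneg power2_le_imp_le[of "D t" "D s"] by simp
  have "(D t)\<^sup>2 \<le> (D s)\<^sup>2 - 2 * \<kappa> * (t - s) * D t" if "0 \<le> s" "s \<le> t" for s t
    using dist_step[OF that, of "D t"] mono that by (simp add: algebra_simps)
  then obtain T where "T > 0" and T: "\<And>t. t \<ge> T \<Longrightarrow> D t = 0"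
    using finite_time_extinction[of \<kappa> D] \<open>\<kappa> > 0\<close> nonneg by blast
  have "y t \<in> translate F (c t)" if "t \<ge> T" for t
  proof -
    have "?B (z t) \<in> ?B ` F"
      using T[OF that] BF by (simp add: D_def in_closed_iff_infdist_zero compact_imp_closed)
    then have "z t \<in> F" using inj_root_map[OF A] by (simp add: inj_image_mem_iff)
    then show ?thesis by (auto simp: translate_def z_def intro!: image_eqI[of _ _ "y t - c t"])
  qed
  then show ?thesis using \<open>T > 0\<close> by blast
qed

section \<open>Inclusion of normal cones and arrival in the moving face\<close>

theorem corollary3:
  fixes V :: "(real ^ 'm) set"
    and A :: "real ^ 'm ^ 'm"
    and d M :: nat
    and c :: "real \<Rightarrow> real ^ 'm"
    and c1 :: "real ^ 'm"
    and cm cp :: "'m \<Rightarrow> real"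
    and I :: "nat \<Rightarrow> (int \<times> 'm) set"
    and J :: "real ^ 'm \<Rightarrow> nat set"
    and ystar :: "nat \<Rightarrow> real ^ 'm"
    and C F :: "(real ^ 'm) set"
  assumes V: "subspace V" "dim V = d"
    and A: "diagonal_positive A"
    and c_V: "\<And>t. t \<ge> 0 \<Longrightarrow> c t \<in> V"
    and c1_V: "c1 \<in> V"
    and c_deriv: "\<And>t. t \<ge> 0 \<Longrightarrow> (c has_vector_derivative c1) (at t within {0..})"
    and M: "M \<ge> 1"
    and I: "\<And>i. i \<le> M \<Longrightarrow> I i \<subseteq> {-1, 1} \<times> UNIV"
    and C: "C = Cset V A cm cp"
    and F: "F = Fset V A cm cp I M"
    and riF: "rel_interior F \<noteq> {}"
    and h1: "\<And>i. i \<in> {1..M} \<Longrightarrow>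
               hyper_inter V A cm cp (I 0 \<union> I i) = {ystar i} \<and> ystar i \<in> F"
    and h2: "\<And>y. y \<in> F \<Longrightarrow>
               J y \<subseteq> {1..M} \<and> active V A cm cp y = I 0 \<union> inter_or_empty I (J y)"
    and h3: "\<And>i. i \<in> {1..M} \<Longrightarrow>
               J (ystar i) = {i} \<and> active V A cm cp (ystar i) = I 0 \<union> I i"
    and h4: "\<And>y. y \<in> rel_interior F \<Longrightarrow> active V A cm cp y = I 0"
    and h5: "F \<subseteq> C"
    and c1_ri: "\<And>y. y \<in> rel_interior F \<Longrightarrow> - c1 \<in> rel_interior (normal_cone V A C y)"
  shows "(\<exists>\<epsilon>>0. \<forall>\<tau>\<^sub>d>0. \<forall>y\<in>F. \<forall>t\<in>{0..\<tau>\<^sub>d}.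
            translate (Aball V A \<epsilon> \<inter> normal_cone V A F y)
              (- vector_derivative c (at t within {0..})) \<subseteq> normal_cone V A C y)
       \<and> (\<forall>y. sweeping_solution V A (\<lambda>t. translate C (c t)) y \<and> y 0 \<in> translate C (c 0) \<longrightarrow>
            (\<exists>T>0. \<forall>\<tau>\<^sub>d\<ge>T. y \<tau>\<^sub>d \<in> translate F (c \<tau>\<^sub>d)))"
proof -
  obtain y0 where y0: "y0 \<in> rel_interior F" using riF by blast
  then have y0F: "y0 \<in> F" using rel_interior_subset by blast
  have face: "F = {x \<in> C. - c1 \<bullet> (A *v (x - y0)) = 0}"
    unfolding C
  proof (rule Fset_exposed[OF V(1) A _ _ y0])
    show "I 0 \<subseteq> {-1, 1} \<times> UNIV" using I by blast
    show "F = Cset V A cm cp \<inter> hyper_inter V A cm cp (I 0)"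
      using Fset_eq_face[of M I V A cm cp] I h5 unfolding C F by blast
    show "- c1 \<in> rel_interior (normal_cone V A (Cset V A cm cp) y0)"
      using c1_ri[OF y0] C by simp
  qed
  have min: "c1 \<bullet> (A *v (x - y0)) \<ge> 0" if "x \<in> C" for x
    using c1_ri[OF y0] rel_interior_subset[of "normal_cone V A C y0"] that
    by (auto simp: normal_cone_def split: if_splits)
  obtain \<kappa> where "\<kappa> > 0" and sharp: "\<And>x q. x \<in> C \<Longrightarrow> q \<in> F \<Longrightarrow>
      \<exists>p\<in>F. \<kappa> * Anorm A (x - p) \<le> c1 \<bullet> (A *v (x - q))"
  proof (rule face_sharp[OF V(1) A y0F, of cm cp c1])
    show "F = {x \<in> Cset V A cm cp. c1 \<bullet> (A *v (x - y0)) = 0}"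
      by (subst face) (simp add: C)
  qed (use min in \<open>auto simp: C\<close>)
  have "polytope C" unfolding C by (rule polytope_Cset[OF V(1) A])
  then have "compact C" by (rule polytope_imp_compact)
  \<comment> \<open>\<open>c1 v* A\<close> is the Euclidean normal of the exposing hyperplane, so
    \<open>F\<close> is a closed slice of the compact set \<open>C\<close>.\<close>
  have "F = C \<inter> {x. (c1 v* A) \<bullet> x = (c1 v* A) \<bullet> y0}"
    by (subst face) (auto simp: dot_lmul_matrix matrix_vector_mult_diff_distrib inner_diff_right)
  then have "compact F"
    using compact_Int_closed[OF \<open>compact C\<close> closed_hyperplane] by metis
  have cder: "vector_derivative c (at t within {0..}) = c1" if "t \<ge> 0" for t
  proof (rule vector_derivative_within[OF _ c_deriv[OF that]])
    \<comment> \<open>The right-sided filter shows that \<open>t\<close> is not isolated in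
      \<open>{0..}\<close>, even for \<open>t = 0\<close>, so the derivative is unique.\<close>
    have "at t within {t<..} \<le> at t within {0..}" using that by (intro at_le) auto
    then show "at t within {0..} \<noteq> bot"
      using trivial_limit_at_right_real[of t] by (metis bot.extremum_uniqueI trivial_limit_def)
  qed
  \<comment> \<open>A constant velocity makes \<open>c\<close> affine on the half-line, the form in
    which the moving frame enters.\<close>
  have "((\<lambda>t. c t - t *\<^sub>R c1) has_derivative (\<lambda>h. 0)) (at t within {0..})" if "t \<ge> 0" for t
  proof -
    have "((\<lambda>t. c t - t *\<^sub>R c1) has_vector_derivative c1 - 1 *\<^sub>R c1) (at t within {0..})"
      by (auto intro!: derivative_eq_intros c_deriv[OF that])
    then show ?thesis by (simp add: has_vector_derivative_def)
  qed
  then obtain c0 where "\<And>t. t \<ge> 0 \<Longrightarrow> c t - t *\<^sub>R c1 = c0"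
    using has_derivative_zero_constant[of "{0..}" "\<lambda>t. c t - t *\<^sub>R c1"] by auto
  then have c: "c t = c0 + t *\<^sub>R c1" if "t \<ge> 0" for t
    using that by (metis diff_add_cancel)
  show ?thesis
  proof (intro conjI allI impI)
    show "\<exists>\<epsilon>>0. \<forall>\<tau>\<^sub>d>0. \<forall>y\<in>F. \<forall>t\<in>{0..\<tau>\<^sub>d}.
        translate (Aball V A \<epsilon> \<inter> normal_cone V A F y)
          (- vector_derivative c (at t within {0..})) \<subseteq> normal_cone V A C y"
      \<comment> \<open>The radius \<kappa> depends neither on the time horizon nor on
        \<open>t\<close>, because the velocity is always \<open>c1\<close>.\<close>
      using face_drift_subset_normal_cone[OF V(1) A c1_V h5 sharp] \<open>\<kappa> > 0\<close>
      by (intro exI[of _ \<kappa>]) (simp add: cder)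
    fix y assume "sweeping_solution V A (\<lambda>t. translate C (c t)) y \<and> y 0 \<in> translate C (c 0)"
    then show "\<exists>T>0. \<forall>\<tau>\<^sub>d\<ge>T. y \<tau>\<^sub>d \<in> translate F (c \<tau>\<^sub>d)"
      using sweeping_reaches_face[OF A compact_imp_bounded[OF \<open>compact C\<close>] \<open>compact F\<close> _ h5 \<open>\<kappa> > 0\<close> c sharp]
        y0F by blast
  qed
qed

end
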